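(* Let $M$ be a nested matroid on a ground set $E=\{e_1,\ldots,e_n\}$ and, for $i\in\{0,\ldots,n\}$, let $E_i=\{e_1,\ldots,e_i\}$. Then the number of minors of $M$ on $E\setminus E_i$ is at most $2^{\lambda_M(E_i)}$.
   Context: A matroid $M$ on $E$ is transversal if there are subsets $A_1,\ldots,A_m\subseteq E$ (a presentation) such that $I\subseteq E$ is independent iff there is an injection $\varphi\colon I\to\{1,\ldots,m\}$ with $e\in A_{\varphi(e)}$ for all $e\in I$; it is nested if it has such a presentation with $A_1\subseteq\cdots\subseteq A_m$. $r_M$ is the rank function, $r(M)=r_M(E)$, and $\lambda_M(X)=r_M(X)+r_M(E\setminus X)-r(M)$. For disjoint $X,Y\subseteq E$, $M\setminus X/Y$ is the matroid obtained by deleting $X$ and contracting $Y$. The minors of $M$ on $E\setminus E_i$ are the matroids $M\setminus(E_i\setminus Y)/Y$ for $Y\subseteq E_i$; their number is the number of distinct such matroids. *)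

theory Defs
  imports Main
begin

record 'a set_system =
  ground :: "'a set"
  indep :: "'a set set"

definition matroid :: "'a set_system \<Rightarrow> bool" where
  "matroid M \<longleftrightarrow>
     finite (ground M) \<and>
     indep M \<subseteq> Pow (ground M) \<and>
     {} \<in> indep M \<and>
     (\<forall>I\<in>indep M. \<forall>J. J \<subseteq> I \<longrightarrow> J \<in> indep M) \<and>
     (\<forall>I\<in>indep M. \<forall>J\<in>indep M. card I < card J \<longrightarrow> (\<exists>x\<in>J - I. insert x I \<in> indep M))"

definition presentation :: "'a set_system \<Rightarrow> nat \<Rightarrow> (nat \<Rightarrow> 'a set) \<Rightarrow> bool" where
  "presentation M m A \<longleftrightarrow>
     (\<forall>j\<in>{1..m}. A j \<subseteq> ground M) \<and>
     (\<forall>I. I \<subseteq> ground M \<longrightarrow>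
        (I \<in> indep M \<longleftrightarrow>
          (\<exists>\<phi>. inj_on \<phi> I \<and> \<phi> ` I \<subseteq> {1..m} \<and> (\<forall>e\<in>I. e \<in> A (\<phi> e)))))"

definition nested_matroid :: "'a set_system \<Rightarrow> bool" where
  "nested_matroid M \<longleftrightarrow>
     matroid M \<and> (\<exists>m A. presentation M m A \<and> mono_on {1..m} A)"

definition rank :: "'a set_system \<Rightarrow> 'a set \<Rightarrow> nat" where
  "rank M X = Max (card ` {I. I \<in> indep M \<and> I \<subseteq> X})"

text \<open>For a matroid the subtraction on \<^typ>\<open>nat\<close> does not truncate
  if \<^term>\<open>X \<subseteq> ground M\<close>; see \<open>rank_ground_le\<close> below.\<close>

definition connectivity :: "'a set_system \<Rightarrow> 'a set \<Rightarrow> nat" where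
  "connectivity M X = rank M X + rank M (ground M - X) - rank M (ground M)"

definition basis_of :: "'a set_system \<Rightarrow> 'a set \<Rightarrow> 'a set \<Rightarrow> bool" where
  "basis_of M Y B \<longleftrightarrow>
     B \<in> indep M \<and> B \<subseteq> Y \<and> (\<forall>C\<in>indep M. B \<subseteq> C \<and> C \<subseteq> Y \<longrightarrow> C = B)"

definition delete :: "'a set_system \<Rightarrow> 'a set \<Rightarrow> 'a set_system" where
  "delete M X = \<lparr>ground = ground M - X, indep = {I \<in> indep M. I \<inter> X = {}}\<rparr>"

text \<open>By \<open>contract_basis\<close> below, the choice of the basis of \<open>Y\<close> does not matter.\<close>

definition contract :: "'a set_system \<Rightarrow> 'a set \<Rightarrow> 'a set_system" where
  "contract M Y =
     \<lparr>ground = ground M - Y,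
      indep = {I. I \<subseteq> ground M - Y \<and> (\<exists>B. basis_of M Y B \<and> I \<union> B \<in> indep M)}\<rparr>"

definition minors_removing :: "'a set_system \<Rightarrow> 'a set \<Rightarrow> 'a set_system set" where
  "minors_removing M S = (\<lambda>Y. contract (delete M (S - Y)) Y) ` Pow S"

lemma matroid_finite: "matroid M \<Longrightarrow> I \<in> indep M \<Longrightarrow> finite I"
  unfolding matroid_def by (metis Pow_iff finite_subset subsetD)

lemma matroid_subset: "matroid M \<Longrightarrow> I \<in> indep M \<Longrightarrow> J \<subseteq> I \<Longrightarrow> J \<in> indep M"
  unfolding matroid_def by metis

lemma matroid_augment:
  "matroid M \<Longrightarrow> I \<in> indep M \<Longrightarrow> J \<in> indep M \<Longrightarrow> card I < card J \<Longrightarrow>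
    \<exists>x\<in>J - I. insert x I \<in> indep M"
  unfolding matroid_def by metis

lemma matroid_finite_indep: "matroid M \<Longrightarrow> finite (indep M)"
  unfolding matroid_def by (meson finite_Pow_iff finite_subset)

lemma card_le_rank:
  assumes "matroid M" "I \<in> indep M" "I \<subseteq> X"
  shows "card I \<le> rank M X"
  unfolding rank_def using assms matroid_finite_indep[OF assms(1)] by (intro Max_ge) auto

lemma rank_attained:
  assumes "matroid M"
  obtains I where "I \<in> indep M" "I \<subseteq> X" "card I = rank M X"
proof -
  have "{} \<in> {I. I \<in> indep M \<and> I \<subseteq> X}" using assms unfolding matroid_def by simp
  hence "rank M X \<in> card ` {I. I \<in> indep M \<and> I \<subseteq> X}"
    unfolding rank_def using matroid_finite_indep[OF assms] by (intro Max_in) auto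
  thus thesis using that by auto
qed

lemma rank_ground_le:
  assumes "matroid M" "X \<subseteq> ground M"
  shows "rank M (ground M) \<le> rank M X + rank M (ground M - X)"
proof -
  obtain I where I: "I \<in> indep M" "I \<subseteq> ground M" "card I = rank M (ground M)"
    using rank_attained[OF assms(1)] .
  have "card I = card (I \<inter> X) + card (I - X)"
    using matroid_finite[OF assms(1) I(1)]
    by (metis card_Diff_subset_Int card_mono finite_Int inf_le1 le_add_diff_inverse)
  moreover have "card (I \<inter> X) \<le> rank M X"
    using card_le_rank[OF assms(1) matroid_subset[OF assms(1) I(1)]] by auto
  moreover have "card (I - X) \<le> rank M (ground M - X)"
    using I(2) by (intro card_le_rank[OF assms(1) matroid_subset[OF assms(1) I(1)]]) auto
  ultimately show ?thesis using I(3) by simp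
qed

lemma matroid_extend:
  assumes "matroid M" "I \<in> indep M" "J \<in> indep M" "card I \<le> card J"
  obtains K where "K \<in> indep M" "I \<subseteq> K" "K \<subseteq> I \<union> J" "card K = card J"
proof -
  have "\<exists>K. K \<in> indep M \<and> I \<subseteq> K \<and> K \<subseteq> I \<union> J \<and> card K = card J"
    using assms(2,4)
  proof (induction "card J - card I" arbitrary: I)
    case 0
    then show ?case by (intro exI[of _ I]) auto
  next
    case (Suc d)
    then have "card I < card J" by simp
    then obtain x where x: "x \<in> J - I" "insert x I \<in> indep M"
      using matroid_augment[OF assms(1) Suc.prems(1) assms(3)] by blast
    have c: "card (insert x I) = Suc (card I)"
      using x matroid_finite[OF assms(1) Suc.prems(1)] by simp
    have "\<exists>K. K \<in> indep M \<and> insert x I \<subseteq> K \<and> K \<subseteq> insert x I \<union> J \<and> card K = card J"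
      using Suc.hyps(2) \<open>card I < card J\<close> c x by (intro Suc.hyps(1)) auto
    then show ?case using x(1) by blast
  qed
  then show thesis using that by blast
qed

lemma basis_card_le:
  assumes "matroid M" "basis_of M Y B" "I \<in> indep M" "I \<subseteq> Y"
  shows "card I \<le> card B"
proof (rule ccontr)
  assume "\<not> card I \<le> card B"
  then obtain x where "x \<in> I - B" "insert x B \<in> indep M"
    using matroid_augment[OF assms(1) _ assms(3), of B] assms(2) unfolding basis_of_def by auto
  then show False using assms(2,4) unfolding basis_of_def by blast
qed

lemma basis_card_eq:
  "matroid M \<Longrightarrow> basis_of M Y B \<Longrightarrow> basis_of M Y B' \<Longrightarrow> card B = card B'"
  by (meson basis_card_le basis_of_def le_antisym)

lemma basis_exists:
  assumes "matroid M"
  obtains B where "basis_of M Y B"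
proof -
  obtain I where I: "I \<in> indep M" "I \<subseteq> Y" "card I = rank M Y"
    using rank_attained[OF assms] .
  have "C = I" if "C \<in> indep M" "I \<subseteq> C" "C \<subseteq> Y" for C
    using card_le_rank[OF assms that(1,3)] I(3) matroid_finite[OF assms that(1)] that(2)
    by (metis card_seteq)
  then show thesis using that I unfolding basis_of_def by blast
qed

lemma basis_exchange:
  assumes "matroid M" "basis_of M Y B" "basis_of M Y B'" "I \<inter> Y = {}" "I \<union> B' \<in> indep M"
  shows "I \<union> B \<in> indep M"
proof -
  have B: "B \<in> indep M" "B \<subseteq> Y" and B': "B' \<in> indep M" "B' \<subseteq> Y"
    using assms(2,3) unfolding basis_of_def by auto
  have fin: "finite I" "finite B" "finite B'"
    using matroid_finite[OF assms(1)] assms(5) B(1) by (auto dest: matroid_finite)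
  have cI: "card (I \<union> B') = card I + card B'"
    using fin assms(4) B' by (intro card_Un_disjoint) auto
  have cB: "card B = card B'" using basis_card_eq[OF assms(1-3)] .
  obtain K where K: "K \<in> indep M" "B \<subseteq> K" "K \<subseteq> B \<union> (I \<union> B')" "card K = card (I \<union> B')"
    using matroid_extend[OF assms(1) B(1) assms(5)] cI cB by auto
  have "K \<inter> Y \<in> indep M" using matroid_subset[OF assms(1) K(1)] by auto
  moreover have "B \<subseteq> K \<inter> Y" "K \<inter> Y \<subseteq> Y" using K(2) B(2) by auto
  ultimately have KY: "K \<inter> Y = B" using assms(2) unfolding basis_of_def by metis
  have sub: "K \<subseteq> I \<union> B" using KY K(3) B(2) B'(2) by blast
  have "card (I \<union> B) = card I + card B"
    using fin assms(4) B by (intro card_Un_disjoint) auto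
  then have "K = I \<union> B" using card_seteq[OF _ sub] K(4) cI cB fin by simp
  then show ?thesis using K(1) by simp
qed

lemma contract_basis:
  assumes "matroid M" "basis_of M Y B"
  shows "I \<in> indep (contract M Y) \<longleftrightarrow> I \<subseteq> ground M - Y \<and> I \<union> B \<in> indep M"
proof
  assume "I \<in> indep (contract M Y)"
  then obtain B' where "I \<subseteq> ground M - Y" "basis_of M Y B'" "I \<union> B' \<in> indep M"
    unfolding contract_def by auto
  then show "I \<subseteq> ground M - Y \<and> I \<union> B \<in> indep M"
    using basis_exchange[OF assms, of B' I] by blast
qed (use assms in \<open>auto simp: contract_def\<close>)

lemma matroid_delete:
  assumes "matroid M"
  shows "matroid (delete M X)"
proof -
  have "\<exists>x\<in>J - I. insert x I \<in> indep (delete M X)"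
    if "I \<in> indep (delete M X)" "J \<in> indep (delete M X)" "card I < card J" for I J
    using matroid_augment[OF assms, of I J] that unfolding delete_def by auto
  moreover have "J \<in> indep (delete M X)" if "I \<in> indep (delete M X)" "J \<subseteq> I" for I J
    using matroid_subset[OF assms] that unfolding delete_def by auto
  moreover have "finite (ground M)" "indep M \<subseteq> Pow (ground M)" "{} \<in> indep M"
    using assms unfolding matroid_def by auto
  then have "finite (ground (delete M X))" "indep (delete M X) \<subseteq> Pow (ground (delete M X))"
    "{} \<in> indep (delete M X)"
    unfolding delete_def by auto
  ultimately show ?thesis unfolding matroid_def by blast
qed

lemma matroid_contract:
  assumes "matroid M"
  shows "matroid (contract M Y)"
proof -
  obtain B where B: "basis_of M Y B" using basis_exists[OF assms] .
  note indep_iff = contract_basis[OF assms B]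
  have BY: "B \<subseteq> Y" "B \<in> indep M" using B unfolding basis_of_def by auto
  have g: "ground (contract M Y) = ground M - Y" by (simp add: contract_def)
  have aug: "\<exists>x\<in>J - I. insert x I \<in> indep (contract M Y)"
    if "I \<in> indep (contract M Y)" "J \<in> indep (contract M Y)" and lt: "card I < card J" for I J
  proof -
    have *: "I \<subseteq> ground M - Y" "J \<subseteq> ground M - Y" "I \<union> B \<in> indep M" "J \<union> B \<in> indep M"
      using that(1,2) unfolding indep_iff by auto
    have fin: "finite I" "finite J" "finite B" using *(3,4) by (auto dest: matroid_finite[OF assms])
    have "card (I \<union> B) = card I + card B" "card (J \<union> B) = card J + card B"
      using fin * BY by (auto intro!: card_Un_disjoint)
    then obtain x where "x \<in> (J \<union> B) - (I \<union> B)" "insert x (I \<union> B) \<in> indep M"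
      using matroid_augment[OF assms *(3,4)] lt by auto
    then show ?thesis unfolding indep_iff using * by (intro bexI[of _ x]) auto
  qed
  have her: "J \<in> indep (contract M Y)" if "I \<in> indep (contract M Y)" "J \<subseteq> I" for I J
  proof -
    have "J \<union> B \<subseteq> I \<union> B" using that by auto
    then show ?thesis
      using that matroid_subset[OF assms, of "I \<union> B" "J \<union> B"] unfolding indep_iff by auto
  qed
  have "finite (ground M)" using assms unfolding matroid_def by auto
  then have "finite (ground (contract M Y))" by (simp add: g)
  moreover have "indep (contract M Y) \<subseteq> Pow (ground (contract M Y))" unfolding contract_def by auto
  moreover have "{} \<in> indep (contract M Y)"
    using BY contract_basis[OF assms B, of "{}"] by simp
  ultimately show ?thesis
    unfolding matroid_def
    apply (intro conjI ballI allI impI)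
        apply assumption+
     apply (erule (1) her)
    apply (erule (2) aug)
    done
qed

end

theory Submission
  imports Defs "HOL-Library.FuncSet"
begin

text \<open>A nested matroid is given by a chain \<open>F 0 \<subseteq> \<dots> \<subseteq> F m = E\<close>: a set \<open>I\<close> is independent iff
  \<open>\<bar>I \<inter> F k\<bar> \<le> k\<close> for all \<open>k\<close>. Put \<open>T = E - S\<close> and \<open>X k = T \<inter> F k\<close>. The minor on \<open>T\<close> that
  contracts \<open>Y \<subseteq> S\<close> and deletes \<open>S - Y\<close> is determined by its ranks on the chain \<open>X\<close>, hence by the
  increments \<open>r (X (k + 1) \<union> Y) - r (X k \<union> Y)\<close>. By submodularity each increment is antitone
  in \<open>Y\<close>, so it lies between its values for \<open>Y = S\<close> and \<open>Y = {}\<close>. The differences of these two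
  values add up to \<open>r T - (r E - r S)\<close>, the connectivity of \<open>S\<close>, and \<open>d + 1 \<le> 2 ^ d\<close> bounds the number
  of possible increment vectors.\<close>

section \<open>Submodularity of the rank function\<close>

lemma rank_mono:
  assumes "matroid M" "X \<subseteq> Y"
  shows "rank M X \<le> rank M Y"
proof -
  obtain I where "I \<in> indep M" "I \<subseteq> X" "card I = rank M X"
    using rank_attained[OF assms(1)] .
  then show ?thesis using card_le_rank[OF assms(1), of I Y] assms(2) by auto
qed

text \<open>Extend a largest independent subset of \<open>A \<inter> B\<close> to a largest one
  \<open>K\<close> of \<open>A \<union> B\<close>. Then \<open>K \<inter> A\<close> and
  \<open>K \<inter> B\<close> cover \<open>K\<close> and share at least the first set, so counting
  them gives the inequality.\<close>

lemma rank_submodular: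
  assumes "matroid M"
  shows "rank M (A \<union> B) + rank M (A \<inter> B) \<le> rank M A + rank M B"
proof -
  obtain I where I: "I \<in> indep M" "I \<subseteq> A \<inter> B" "card I = rank M (A \<inter> B)"
    using rank_attained[OF assms] .
  obtain J where J: "J \<in> indep M" "J \<subseteq> A \<union> B" "card J = rank M (A \<union> B)"
    using rank_attained[OF assms] .
  have "card I \<le> card J"
    using I J rank_mono[OF assms, of "A \<inter> B" "A \<union> B"] by auto
  then obtain K where K: "K \<in> indep M" "I \<subseteq> K" "K \<subseteq> I \<union> J" "card K = card J"
    using matroid_extend[OF assms I(1) J(1)] by blast
  have fin: "finite K" using matroid_finite[OF assms K(1)] .
  have "card (K \<inter> A) + card (K \<inter> B) = card (K \<inter> A \<union> K \<inter> B) + card (K \<inter> A \<inter> (K \<inter> B))"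
    using fin by (intro card_Un_Int) auto
  moreover have "K \<inter> A \<union> K \<inter> B = K" using K(3) I(2) J(2) by auto
  moreover have "card I \<le> card (K \<inter> A \<inter> (K \<inter> B))"
    using fin I(2) K(2) by (intro card_mono) auto
  moreover have "card (K \<inter> A) \<le> rank M A" "card (K \<inter> B) \<le> rank M B"
    by (auto intro!: card_le_rank[OF assms] matroid_subset[OF assms K(1)])
  ultimately show ?thesis using I(3) J(3) K(4) by simp
qed

text \<open>Submodularity for \<open>X' \<union> Y\<close> and \<open>X \<union> Y'\<close>: their
  union is \<open>X' \<union> Y'\<close> and their intersection contains
  \<open>X \<union> Y\<close>.\<close>

lemma rank_increment_antitone:
  assumes "matroid M" "X \<subseteq> X'" "Y \<subseteq> Y'"
  shows "rank M (X' \<union> Y') - rank M (X \<union> Y') \<le> rank M (X' \<union> Y) - rank M (X \<union> Y)"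
proof -
  have "rank M (X' \<union> Y \<union> (X \<union> Y')) + rank M ((X' \<union> Y) \<inter> (X \<union> Y'))
      \<le> rank M (X' \<union> Y) + rank M (X \<union> Y')"
    by (rule rank_submodular[OF assms(1)])
  moreover have "X' \<union> Y \<union> (X \<union> Y') = X' \<union> Y'" using assms by auto
  moreover have "rank M (X \<union> Y) \<le> rank M ((X' \<union> Y) \<inter> (X \<union> Y'))"
    using assms by (intro rank_mono) auto
  ultimately show ?thesis by simp
qed

lemma rank_basis:
  assumes "matroid M" "basis_of M Y B"
  shows "card B = rank M Y"
proof -
  obtain I where "I \<in> indep M" "I \<subseteq> Y" "card I = rank M Y"
    using rank_attained[OF assms(1)] .
  then have "rank M Y \<le> card B" using basis_card_le[OF assms] by metis
  moreover have "card B \<le> rank M Y"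
    using assms card_le_rank unfolding basis_of_def by metis
  ultimately show ?thesis by simp
qed

section \<open>Chain description of nested matroids\<close>

text \<open>Numbering \<open>I\<close> by increasing \<open>v\<close> works. The newest element has
  the largest \<open>v\<close>, so the hypothesis at that value counts all elements so far, and the
  number \<open>Suc (card S)\<close> fits under \<open>v x\<close>.\<close>

lemma greedy_matching:
  fixes v :: "'a \<Rightarrow> nat"
  assumes "finite I" "\<And>k. k \<in> v ` I \<Longrightarrow> card {x \<in> I. v x \<le> k} \<le> k"
  shows "\<exists>\<psi>. bij_betw \<psi> I {1..card I} \<and> (\<forall>x\<in>I. \<psi> x \<le> v x)"
  using assms
proof (induction rule: finite_ranking_induct[where f = v])
  case empty
  then show ?case by (simp add: bij_betw_def)
next
  case (insert x S)
  show ?case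
  \<comment> \<open>\<open>finite_ranking_induct\<close> does not guarantee that the inserted
    element is new.\<close>
  proof (cases "x \<in> S")
    case True
    then show ?thesis using insert by (simp add: insert_absorb)
  next
    case False
    have "card {y \<in> S. v y \<le> k} \<le> k" if "k \<in> v ` S" for k
    proof -
      have "card {y \<in> S. v y \<le> k} \<le> card {y \<in> insert x S. v y \<le> k}"
        using insert(1) by (intro card_mono) auto
      also have "\<dots> \<le> k" using insert.prems that by blast
      finally show ?thesis .
    qed
    then obtain \<psi> where \<psi>: "bij_betw \<psi> S {1..card S}" "\<forall>y\<in>S. \<psi> y \<le> v y"
      using insert.IH by blast
    have "{y \<in> insert x S. v y \<le> v x} = insert x S" using insert(2) by auto
    then have "Suc (card S) \<le> v x"
      using insert.prems[of "v x"] insert(1) False by simp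
    moreover have "bij_betw (\<psi>(x := Suc (card S))) (insert x S) {1..card (insert x S)}"
    proof -
      have "bij_betw (\<psi>(x := Suc (card S))) S {1..card S}"
        using \<psi>(1) False bij_betw_cong[of S "\<psi>(x := Suc (card S))" \<psi>] by fastforce
      moreover have "bij_betw (\<psi>(x := Suc (card S))) {x} {Suc (card S)}"
        by (simp add: bij_betw_def)
      ultimately have "bij_betw (\<psi>(x := Suc (card S))) (S \<union> {x}) ({1..card S} \<union> {Suc (card S)})"
        by (rule bij_betw_combine) simp
      then show ?thesis using insert(1) False by (simp add: atLeastAtMostSuc_conv)
    qed
    moreover have "\<forall>y\<in>insert x S. (\<psi>(x := Suc (card S))) y \<le> v y"
      using \<psi>(2) False calculation(1) by auto
    ultimately show ?thesis by blast
  qed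
qed

text \<open>Necessity of the bounds is the pigeonhole principle. For sufficiency, the elements of
  \<open>I\<close>, ordered by their entry \<open>v\<close> into the chain, get the indices from
  \<open>m\<close> downwards: those that lie in the fewest sets go first, and nestedness supplies
  membership.\<close>

lemma nested_matroid_chain:
  assumes "nested_matroid M"
  obtains F m where "mono F" "F m = ground M"
    "\<forall>I\<subseteq>ground M. I \<in> indep M \<longleftrightarrow> (\<forall>k\<le>m. card (I \<inter> F k) \<le> k)"
proof -
  obtain m A where M: "matroid M" and P: "presentation M m A" and mono: "mono_on {1..m} A"
    using assms unfolding nested_matroid_def by auto
  have fin: "finite (ground M)" using M unfolding matroid_def by auto
  \<comment> \<open>For \<open>k \<le> m\<close>, \<open>F k\<close> holds the elements that can
    only be matched to the top \<open>k\<close> indices; \<open>F 0\<close> consists of those in no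
    set of the presentation.\<close>
  define F where "F k = {x \<in> ground M. \<forall>j\<in>{1..m - k}. x \<notin> A j}" for k
  have monoF: "mono F" unfolding F_def by (rule monoI) auto
  have Fm: "F m = ground M" unfolding F_def by auto
  have "I \<in> indep M \<longleftrightarrow> (\<forall>k\<le>m. card (I \<inter> F k) \<le> k)" if I: "I \<subseteq> ground M" for I
  proof -
    have finI: "finite I" using I fin finite_subset by blast
    have "(\<exists>\<phi>. inj_on \<phi> I \<and> \<phi> ` I \<subseteq> {1..m} \<and> (\<forall>e\<in>I. e \<in> A (\<phi> e)))
        \<longleftrightarrow> (\<forall>k\<le>m. card (I \<inter> F k) \<le> k)" (is "?L \<longleftrightarrow> ?R")
    proof
      assume ?L
      then obtain \<phi> where \<phi>: "inj_on \<phi> I" "\<phi> ` I \<subseteq> {1..m}" "\<forall>e\<in>I. e \<in> A (\<phi> e)" by auto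
      show ?R
      proof (intro allI impI)
        fix k assume k: "k \<le> m"
        have "\<phi> ` (I \<inter> F k) \<subseteq> {m - k<..m}"
        proof
          fix j assume "j \<in> \<phi> ` (I \<inter> F k)"
          then obtain x where x: "x \<in> I" "x \<in> F k" "j = \<phi> x" by auto
          then have "x \<in> A j" "j \<in> {1..m}" using \<phi> by auto
          then show "j \<in> {m - k<..m}" using x(2) unfolding F_def by force
        qed
        then have "card (\<phi> ` (I \<inter> F k)) \<le> card {m - k<..m}" by (intro card_mono) auto
        moreover have "card (\<phi> ` (I \<inter> F k)) = card (I \<inter> F k)"
          using \<phi>(1) by (intro card_image) (auto simp: inj_on_def)
        ultimately show "card (I \<inter> F k) \<le> k" using k by simp
      qed
    next
      assume R: ?R
      define v where "v x = (LEAST k. x \<in> F k)" for x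
      have v_le: "v x \<le> k \<longleftrightarrow> x \<in> F k" if "x \<in> I" for x k
      proof
        have "x \<in> F (v x)" unfolding v_def using Fm I that LeastI[of "\<lambda>k. x \<in> F k" m] by auto
        then show "x \<in> F k" if "v x \<le> k" using monoD[OF monoF that] by auto
      qed (simp add: v_def Least_le)
      have vm: "v x \<le> m" if "x \<in> I" for x using v_le that Fm I by auto
      have "card {x \<in> I. v x \<le> k} \<le> k" if "k \<in> v ` I" for k
      proof -
        have "{x \<in> I. v x \<le> k} = I \<inter> F k" using v_le by auto
        then show ?thesis using R vm that by auto
      qed
      then obtain \<psi> where \<psi>: "bij_betw \<psi> I {1..card I}" "\<forall>x\<in>I. \<psi> x \<le> v x"
        using greedy_matching[OF finI] by blast
      have \<psi>1: "1 \<le> \<psi> x \<and> \<psi> x \<le> m" if "x \<in> I" for x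
        using bij_betwE[OF \<psi>(1)] \<psi>(2) vm that by fastforce
      define \<phi> where "\<phi> x = Suc m - \<psi> x" for x
      have "inj_on \<phi> I"
      proof (rule inj_onI)
        fix x y assume "x \<in> I" "y \<in> I" "\<phi> x = \<phi> y"
        then have "\<psi> x = \<psi> y" using \<psi>1[of x] \<psi>1[of y] unfolding \<phi>_def by linarith
        then show "x = y" using \<psi>(1) \<open>x \<in> I\<close> \<open>y \<in> I\<close> by (auto simp: bij_betw_def inj_on_def)
      qed
      moreover have \<phi>m: "\<phi> ` I \<subseteq> {1..m}" using \<psi>1 unfolding \<phi>_def by fastforce
      moreover have "x \<in> A (\<phi> x)" if x: "x \<in> I" for x
      proof -
        \<comment> \<open>Being outside \<open>F (\<psi> x - 1)\<close> puts \<open>x\<close> into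
          some \<open>A j\<close> with \<open>j \<le> m - (\<psi> x - 1)\<close>, and this bound is
          \<open>\<phi> x\<close> because \<open>\<psi> x \<ge> 1\<close>.\<close>
        have "\<not> v x \<le> \<psi> x - 1" using \<psi>1[OF x] \<psi>(2) x by fastforce
        then have "x \<notin> F (\<psi> x - 1)" using v_le[OF x] by simp
        then obtain j where j: "j \<in> {1..m - (\<psi> x - 1)}" "x \<in> A j"
          using I x unfolding F_def by auto
        then have "j \<le> \<phi> x" using \<psi>1[OF x] unfolding \<phi>_def by auto
        moreover have "j \<in> {1..m}" "\<phi> x \<in> {1..m}" using j \<phi>m x by auto
        ultimately have "A j \<subseteq> A (\<phi> x)" using mono by (simp add: mono_on_def)
        then show ?thesis using j by auto
      qed
      ultimately show ?L by blast
    qed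
    then show ?thesis using P I unfolding presentation_def by simp
  qed
  then show thesis using that[OF monoF Fm] by blast
qed

section \<open>Minors through ranks along the chain\<close>

lemma indep_minor_iff:
  assumes M: "matroid M" and S: "S \<subseteq> ground M" and Y: "Y \<subseteq> S" and B: "basis_of M Y B"
  shows "I \<in> indep (contract (delete M (S - Y)) Y) \<longleftrightarrow> I \<subseteq> ground M - S \<and> I \<union> B \<in> indep M"
proof -
  have "basis_of (delete M (S - Y)) Y B"
    using B unfolding basis_of_def delete_def by auto
  from contract_basis[OF matroid_delete[OF M] this, of I] show ?thesis
    using B Y S unfolding basis_of_def delete_def by auto
qed

text \<open>Makes the minor depend on \<open>Y\<close> only through the excess of the ranks on the
  right over \<open>rank M Y\<close>. The bounds suffice because of the chain: a largest independent
  set containing a basis \<open>B\<close> of \<open>Y\<close> shows how many elements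
  \<open>F k\<close> can hold besides \<open>B \<inter> F k\<close>.\<close>

lemma indep_minor_iff_chain:
  assumes M: "matroid M" and S: "S \<subseteq> ground M" and Y: "Y \<subseteq> S"
    and chain: "\<forall>I\<subseteq>ground M. I \<in> indep M \<longleftrightarrow> (\<forall>k\<le>m. card (I \<inter> F k) \<le> k)"
  shows "I \<in> indep (contract (delete M (S - Y)) Y) \<longleftrightarrow> I \<subseteq> ground M - S \<and>
    (\<forall>k\<le>m. card (I \<inter> F k) + rank M Y \<le> rank M ((ground M - S) \<inter> F k \<union> Y))"
proof -
  obtain B where B: "basis_of M Y B" using basis_exists[OF M] .
  have BY: "B \<subseteq> Y" "B \<in> indep M" using B unfolding basis_of_def by auto
  have finB: "finite B" using matroid_finite[OF M BY(2)] .
  have finE: "finite (ground M)" using M unfolding matroid_def by auto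
  note cB = rank_basis[OF M B]
  have "I \<union> B \<in> indep M \<longleftrightarrow>
    (\<forall>k\<le>m. card (I \<inter> F k) + rank M Y \<le> rank M ((ground M - S) \<inter> F k \<union> Y))"
    if I: "I \<subseteq> ground M - S"
  proof -
    have finI: "finite I" using I finE finite_subset by blast
    have IB: "I \<inter> B = {}" using I BY Y by auto
    show ?thesis
    proof (intro iffI allI impI)
      fix k assume ind: "I \<union> B \<in> indep M"
      have "card (I \<inter> F k \<union> B) = card (I \<inter> F k) + card B"
        using finI finB IB by (intro card_Un_disjoint) auto
      moreover have "card (I \<inter> F k \<union> B) \<le> rank M ((ground M - S) \<inter> F k \<union> Y)"
        using I BY by (intro card_le_rank[OF M matroid_subset[OF M ind]]) auto
      ultimately show "card (I \<inter> F k) + rank M Y \<le> rank M ((ground M - S) \<inter> F k \<union> Y)"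
        using cB by simp
    next
      assume R: "\<forall>k\<le>m. card (I \<inter> F k) + rank M Y \<le> rank M ((ground M - S) \<inter> F k \<union> Y)"
      have "card ((I \<union> B) \<inter> F k) \<le> k" if k: "k \<le> m" for k
      proof -
        let ?Z = "(ground M - S) \<inter> F k \<union> Y"
        obtain J where J: "J \<in> indep M" "J \<subseteq> ?Z" "card J = rank M ?Z"
          using rank_attained[OF M] .
        have "card B \<le> card J" using cB J(3) rank_mono[OF M, of Y ?Z] by simp
        then obtain K where K: "K \<in> indep M" "B \<subseteq> K" "K \<subseteq> B \<union> J" "card K = card J"
          using matroid_extend[OF M BY(2) J(1)] by blast
        have finK: "finite K" using matroid_finite[OF M K(1)] .
        have KZ: "K \<subseteq> ?Z" using K(3) J(2) BY by auto
        have "K \<inter> Y \<in> indep M" using matroid_subset[OF M K(1)] by auto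
        then have KY: "K \<inter> Y = B"
          using B K(2) BY(1) unfolding basis_of_def by (metis Int_lower2 le_inf_iff)
        \<comment> \<open>\<open>K - B\<close> lies in \<open>F k\<close> and has
          \<open>rank M ?Z - rank M Y\<close> elements, at least as many as
          \<open>I \<inter> F k\<close>. So the chain bound for the independent set \<open>K\<close>
          passes to \<open>I \<union> B\<close>.\<close>
        then have sub: "K - B \<subseteq> F k" using KZ by auto
        have "K \<subseteq> ground M" using M K(1) unfolding matroid_def by auto
        then have "card (K \<inter> F k) \<le> k" using chain K(1) k by blast
        moreover have "K \<inter> F k = (K - B) \<union> (B \<inter> F k)" using sub K(2) by auto
        then have "card (K \<inter> F k) = card (K - B) + card (B \<inter> F k)"
          using finK finB by (simp add: card_Un_disjoint Int_Diff disjoint_iff)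
        moreover have "card (K - B) + card B = rank M ?Z"
          using K finB finK J(3) card_mono[OF finK K(2)] by (simp add: card_Diff_subset)
        moreover have "card (I \<inter> F k) + card B \<le> rank M ?Z" using R k cB by simp
        moreover have "card ((I \<union> B) \<inter> F k) \<le> card (I \<inter> F k) + card (B \<inter> F k)"
          by (simp add: Int_Un_distrib2 card_Un_le)
        ultimately show ?thesis by linarith
      qed
      moreover have "I \<union> B \<subseteq> ground M" using I BY Y S by auto
      ultimately show "I \<union> B \<in> indep M" using chain by blast
    qed
  qed
  then show ?thesis using indep_minor_iff[OF M S Y B] by blast
qed

section \<open>Counting increment vectors\<close>

theorem card_minors_removing_nested:
  assumes nested: "nested_matroid M" and S: "S \<subseteq> ground M"
  shows "card (minors_removing M S) \<le> 2 ^ connectivity M S"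
proof -
  have M: "matroid M" using nested unfolding nested_matroid_def by simp
  obtain F m where F: "mono F" "F m = ground M"
    and chain: "\<forall>I\<subseteq>ground M. I \<in> indep M \<longleftrightarrow> (\<forall>k\<le>m. card (I \<inter> F k) \<le> k)"
    using nested_matroid_chain[OF nested] .
  define X where "X k = (ground M - S) \<inter> F k" for k
  have X_mono: "X k \<subseteq> X (Suc k)" for k
    using monoD[OF F(1), of k "Suc k"] unfolding X_def by auto
  have X_m: "X m = ground M - S" using F(2) unfolding X_def by auto
  define a where "a Y k = rank M (X (Suc k) \<union> Y) - rank M (X k \<union> Y)" for Y k
  \<comment> \<open>The bound at \<open>k = 0\<close> forces independent sets to avoid
    \<open>F 0\<close>, so \<open>X 0\<close> adds no rank and the increments telescope from
    \<open>rank M Y\<close>.\<close>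
  have rank_X0: "rank M (X 0 \<union> Y) = rank M Y" for Y
  proof -
    obtain J where J: "J \<in> indep M" "J \<subseteq> X 0 \<union> Y" "card J = rank M (X 0 \<union> Y)"
      using rank_attained[OF M] .
    have "J \<subseteq> ground M" using M J(1) unfolding matroid_def by auto
    then have "card (J \<inter> F 0) = 0" using chain J(1) by blast
    then have "J \<inter> F 0 = {}" using matroid_finite[OF M J(1)] by simp
    then have "J \<subseteq> Y" using J(2) unfolding X_def by auto
    then have "rank M (X 0 \<union> Y) \<le> rank M Y" using card_le_rank[OF M J(1)] J(3) by metis
    moreover have "rank M Y \<le> rank M (X 0 \<union> Y)" by (intro rank_mono[OF M]) auto
    ultimately show ?thesis by simp
  qed
  have sum_a: "rank M (X k \<union> Y) = rank M Y + (\<Sum>j<k. a Y j)" for Y k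
  proof (induction k)
    case 0
    then show ?case by (simp add: rank_X0)
  next
    case (Suc k)
    have "rank M (X k \<union> Y) \<le> rank M (X (Suc k) \<union> Y)"
      using X_mono[of k] by (intro rank_mono[OF M]) auto
    then show ?case using Suc unfolding a_def by simp
  qed
  have a_antitone: "a Y' k \<le> a Y k" if "Y \<subseteq> Y'" for Y Y' k
    unfolding a_def using rank_increment_antitone[OF M X_mono that] .
  \<comment> \<open>Rebuilds a minor from its increment vector. Not every \<open>b\<close> has to
    come from a minor; the upper bound only asks that every minor is hit.\<close>
  define \<Phi> :: "(nat \<Rightarrow> nat) \<Rightarrow> 'a set_system" where
    "\<Phi> b = \<lparr>ground = ground M - S,
      indep = {I. I \<subseteq> ground M - S \<and> (\<forall>k\<le>m. card (I \<inter> F k) \<le> (\<Sum>j<k. b j))}\<rparr>" for b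
  let ?P = "PiE {..<m} (\<lambda>k. {a S k..a {} k})"
  have "minors_removing M S \<subseteq> \<Phi> ` ?P"
  proof
    fix N assume "N \<in> minors_removing M S"
    then obtain Y where Y: "Y \<subseteq> S" and N: "N = contract (delete M (S - Y)) Y"
      unfolding minors_removing_def by auto
    \<comment> \<open>Restriction makes the vector extensional, hence a member of the finite box
      \<open>?P\<close>; \<open>\<Phi>\<close> reads only the entries below
      \<open>m\<close>.\<close>
    let ?b = "restrict (a Y) {..<m}"
    have b: "?b \<in> ?P" using a_antitone Y by auto
    have "(\<Sum>j<k. ?b j) = (\<Sum>j<k. a Y j)" if "k \<le> m" for k
      using that by (intro sum.cong) auto
    \<comment> \<open>By \<open>sum_a\<close> the term \<open>rank M Y\<close> cancels from the
      criterion, leaving the partial sums of the increments.\<close>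
    then have "I \<in> indep N \<longleftrightarrow> I \<in> indep (\<Phi> ?b)" for I
      using indep_minor_iff_chain[OF M S Y chain, of I] sum_a[of _ Y]
      unfolding N \<Phi>_def by (simp add: X_def[symmetric])
    then have "indep N = indep (\<Phi> ?b)" by blast
    moreover have "ground N = ground (\<Phi> ?b)"
      using Y unfolding N \<Phi>_def contract_def delete_def by auto
    ultimately have "N = \<Phi> ?b" by (cases N) (simp add: \<Phi>_def)
    then show "N \<in> \<Phi> ` ?P" using b by blast
  qed
  moreover have finP: "finite ?P" by (intro finite_PiE) auto
  ultimately have "card (minors_removing M S) \<le> card ?P"
    by (rule surj_card_le[rotated])
  also have "\<dots> = (\<Prod>k<m. card {a S k..a {} k})" by (simp add: card_PiE)
  also have "\<dots> \<le> (\<Prod>k<m. 2 ^ (a {} k - a S k))"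
  proof (intro prod_mono conjI)
    fix k
    have "card {a S k..a {} k} = Suc (a {} k - a S k)"
      using a_antitone[of "{}" S k] by (simp add: Suc_diff_le)
    also have "\<dots> \<le> 2 ^ (a {} k - a S k)" using less_exp[of "a {} k - a S k"] by (rule Suc_leI)
    finally show "card {a S k..a {} k} \<le> 2 ^ (a {} k - a S k)" .
  qed simp
  also have "\<dots> = 2 ^ (\<Sum>k<m. a {} k - a S k)" by (simp add: power_sum)
  also have "(\<Sum>k<m. a {} k - a S k) = connectivity M S"
  proof -
    \<comment> \<open>The two sums telescope separately: since \<open>X m = ground M - S\<close>,
      the first gives the rank of that set and the second gives
      \<open>rank M (ground M) - rank M S\<close>.\<close>
    have "(\<Sum>k<m. a {} k - a S k) = (\<Sum>k<m. a {} k) - (\<Sum>k<m. a S k)"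
      by (rule sum_subtractf_nat) (simp add: a_antitone)
    moreover have "(ground M - S) \<union> S = ground M" using S by auto
    then have "rank M (ground M) = rank M S + (\<Sum>k<m. a S k)"
      using sum_a[of m S] X_m by simp
    moreover have "rank M {} = 0"
    proof -
      obtain J where "J \<in> indep M" "J \<subseteq> {}" "card J = rank M {}"
        using rank_attained[OF M] .
      then show ?thesis by simp
    qed
    then have "rank M (ground M - S) = (\<Sum>k<m. a {} k)"
      using sum_a[of m "{}"] X_m by simp
    ultimately show ?thesis unfolding connectivity_def by simp
  qed
  finally show ?thesis .
qed

theorem theorem4p7:
  fixes M :: "'a set_system" and e :: "nat \<Rightarrow> 'a" and n i :: nat
  assumes "nested_matroid M"
    and "bij_betw e {1..n} (ground M)"
    and "i \<in> {0..n}"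
  shows "card (minors_removing M (e ` {1..i})) \<le> 2 ^ connectivity M (e ` {1..i})"
proof (rule card_minors_removing_nested[OF assms(1)])
  have "e ` {1..i} \<subseteq> e ` {1..n}" using assms(3) by (intro image_mono) auto
  then show "e ` {1..i} \<subseteq> ground M" using assms(2) by (simp add: bij_betw_def)
qed

end
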